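(* Let $\mathcal{P}$ be a distribution on Boolean constraints of arity $k$ such that $SAT(\mathcal{P})$ has a sharp threshold and a second-order phase transition. Then for every constant $c>\limsup_{n\to\infty} c_{SAT(\mathcal{P})}(n)$ and every $\alpha>0$, a random formula from $SAT_{n,cn}(\mathcal{P})$ has, with high probability, resolution complexity $O(2^{k\alpha n})$.
   Context: A Boolean constraint of arity $k$ is a nonempty subset of $\{0,1\}^k$ of allowed assignments; $\mathcal{C}=\mathrm{supp}(\mathcal{P})$. Random model $SAT_{n,M}(\mathcal{P})$: on $n$ variables, choose $M$ $k$-subsets of variables uniformly at random with repetition; for each, take a uniformly random ordering of its variables and apply a constraint drawn according to $\mathcal{P}$. $SAT(\mathcal{P})$ has a sharp threshold if there is $c(n)$ bounded away from $0$ such that for every $\epsilon>0$, formulas from $SAT_{n,M}(\mathcal{P})$ are satisfiable with probability $\to1$ when $M<(c(n)-\epsilon)n$ and with probability $\to0$ when $M>(c(n)+\epsilon)n$. $c_{SAT(\mathcal{P})}(n)$ denotes the threshold constraint density, i.e. the ratio $M/n$ at which the random formula from $SAT_{n,M}(\mathcal{P})$ is satisfiable with probability $1/2$. Spine of a formula $\Phi$ (a conjunction of constraints from $\mathcal{C}$ applied to tuples of variables): $Spine(\Phi)$ is the set of variables $x$ such that there exist a satisfiable subformula $\Xi\subseteq\Phi$ and a constraint from $\mathcal{C}$ applied to a tuple of variables containing $x$, call it $C$, with $\Xi\wedge C$ unsatisfiable. $SAT(\mathcal{P})$ has a second-order phase transition if for every $\epsilon>0$ there is a sequence $M^{\epsilon}(n)$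 such that, for $\Phi$ drawn from $SAT_{n,M^{\epsilon}(n)}(\mathcal{P})$, $\lim_{n}\Pr[\Phi \text{ satisfiable}]=0$ and $\lim_{n}\Pr[|Spine(\Phi)|/n\geq\epsilon]=0$. The resolution complexity of a formula is the minimum size of a resolution refutation of the CNF formula obtained by converting each constraint into CNF. "With high probability" means with probability tending to $1$ as $n\to\infty$. *)

theory Defs
  imports "HOL-Probability.Probability"
begin

(* An element of {0,1}^k is a bool list of length k, and a constraint is the set of its allowed
   assignments. The pair (xs, C) is the constraint C applied to the tuple of variables xs;
   variables are natural numbers, those of an n-variable formula being 0, ..., n - 1. *)
type_synonym boolean_constraint = "bool list set"
type_synonym applied_constraint = "nat list \<times> boolean_constraint"

definition boolean_constraints :: "nat \<Rightarrow> boolean_constraint set" where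
  "boolean_constraints k = {C. C \<noteq> {} \<and> C \<subseteq> {a. length a = k}}"

definition satisfiable :: "applied_constraint set \<Rightarrow> bool" where
  "satisfiable F \<longleftrightarrow> (\<exists>\<sigma> :: nat \<Rightarrow> bool. \<forall>(xs, C) \<in> F. map \<sigma> xs \<in> C)"

(* For n < k there are no k-subsets and pmf_of_set {} is unspecified; all notions below depend
   only on large n. *)
definition random_applied_constraint ::
    "nat \<Rightarrow> nat \<Rightarrow> boolean_constraint pmf \<Rightarrow> applied_constraint pmf" where
  "random_applied_constraint k n P =
     do {
       S \<leftarrow> pmf_of_set {S. S \<subseteq> {..<n} \<and> card S = k};
       xs \<leftarrow> pmf_of_set (permutations_of_set S);
       C \<leftarrow> P;
       return_pmf (xs, C)
     }"

definition SAT_model ::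
    "nat \<Rightarrow> boolean_constraint pmf \<Rightarrow> nat \<Rightarrow> nat \<Rightarrow> applied_constraint list pmf" where
  "SAT_model k P n M = replicate_pmf M (random_applied_constraint k n P)"

definition prob_sat :: "nat \<Rightarrow> boolean_constraint pmf \<Rightarrow> nat \<Rightarrow> nat \<Rightarrow> real" where
  "prob_sat k P n M = measure_pmf.prob (SAT_model k P n M) {\<Phi>. satisfiable (set \<Phi>)}"

(* The inequalities on M are required eventually only: at n = 0 the strict inequality
   M n < (c n - \<epsilon>) * n can never hold. *)
definition sharp_threshold :: "nat \<Rightarrow> boolean_constraint pmf \<Rightarrow> bool" where
  "sharp_threshold k P \<longleftrightarrow>
     (\<exists>c :: nat \<Rightarrow> real.
        (\<exists>\<delta>>0. \<forall>\<^sub>F n in sequentially. \<delta> \<le> c n) \<and>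
        (\<forall>\<epsilon>>0. \<forall>M :: nat \<Rightarrow> nat.
           ((\<forall>\<^sub>F n in sequentially. real (M n) < (c n - \<epsilon>) * real n) \<longrightarrow>
              (\<lambda>n. prob_sat k P n (M n)) \<longlonglongrightarrow> 1) \<and>
           ((\<forall>\<^sub>F n in sequentially. real (M n) > (c n + \<epsilon>) * real n) \<longrightarrow>
              (\<lambda>n. prob_sat k P n (M n)) \<longlonglongrightarrow> 0)))"

(* The probability 1/2 need not be attained at an integer M. As prob_sat is nonincreasing in M,
   the crossing point is taken to be the first M at which it is at most 1/2
   (infinity if there is no such M). *)
definition threshold_density :: "nat \<Rightarrow> boolean_constraint pmf \<Rightarrow> nat \<Rightarrow> ereal" where
  "threshold_density k P n = (INF M \<in> {M. prob_sat k P n M \<le> 1 / 2}. ereal (real M / real n))"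

(* As in the random model, constraints are applied to tuples of k distinct variables. *)
definition spine ::
    "nat \<Rightarrow> boolean_constraint pmf \<Rightarrow> nat \<Rightarrow> applied_constraint list \<Rightarrow> nat set" where
  "spine k P n \<Phi> =
     {x. \<exists>\<Xi> xs C. \<Xi> \<subseteq> set \<Phi> \<and> satisfiable \<Xi> \<and>
           C \<in> set_pmf P \<and> length xs = k \<and> distinct xs \<and> set xs \<subseteq> {..<n} \<and> x \<in> set xs \<and>
           \<not> satisfiable (insert (xs, C) \<Xi>)}"

definition second_order_phase_transition :: "nat \<Rightarrow> boolean_constraint pmf \<Rightarrow> bool" where
  "second_order_phase_transition k P \<longleftrightarrow>
     (\<forall>\<epsilon>>0. \<exists>M :: nat \<Rightarrow> nat.
        (\<lambda>n. prob_sat k P n (M n)) \<longlonglongrightarrow> 0 \<and>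
        (\<lambda>n. measure_pmf.prob (SAT_model k P n (M n))
                {\<Phi>. real (card (spine k P n \<Phi>)) / real n \<ge> \<epsilon>}) \<longlonglongrightarrow> 0)"

(* The literal (x, b) is true iff the variable x has the value b; a clause is the set of its
   literals. *)
type_synonym clause = "(nat \<times> bool) set"

(* One clause per forbidden assignment a, excluding exactly the value a of the tuple xs. *)
definition constraint_cnf :: "applied_constraint \<Rightarrow> clause set" where
  "constraint_cnf = (\<lambda>(xs, C).
     {set (zip xs (map Not a)) | a. length a = length xs \<and> a \<notin> C})"

definition formula_cnf :: "applied_constraint list \<Rightarrow> clause set" where
  "formula_cnf \<Phi> = (\<Union>c \<in> set \<Phi>. constraint_cnf c)"

definition is_resolvent :: "clause \<Rightarrow> clause \<Rightarrow> clause \<Rightarrow> bool" where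
  "is_resolvent D E R \<longleftrightarrow>
     (\<exists>x. (x, True) \<in> D \<and> (x, False) \<in> E \<and> R = (D - {(x, True)}) \<union> (E - {(x, False)}))"

definition resolution_refutation :: "clause set \<Rightarrow> clause list \<Rightarrow> bool" where
  "resolution_refutation F \<pi> \<longleftrightarrow>
     \<pi> \<noteq> [] \<and> last \<pi> = {} \<and>
     (\<forall>i < length \<pi>. \<pi> ! i \<in> F \<or> (\<exists>j < i. \<exists>l < i. is_resolvent (\<pi> ! j) (\<pi> ! l) (\<pi> ! i)))"

(* Infinite for a satisfiable formula. *)
definition resolution_complexity :: "applied_constraint list \<Rightarrow> enat" where
  "resolution_complexity \<Phi> =
     (INF \<pi> \<in> {\<pi>. resolution_refutation (formula_cnf \<Phi>) \<pi>}. enat (length \<pi>))"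

end

(* In a minimal unsatisfiable subformula every constraint witnesses that its own variables lie in
   the spine, so that subformula mentions at most |Spine| variables, and a complete decision tree on
   m variables yields a resolution refutation of size less than 2^(m+1). It remains to see that a
   random formula with c n constraints has, with high probability, an unsatisfiable prefix with a
   small spine. Let M(n) be the sequence given by the second-order phase transition. If M(n) <= c n,
   the prefix of length M(n) works. Otherwise the whole formula works: it is unsatisfiable by the
   sharp threshold, and its spine is small because the spine grows with the formula. *)
theory Submission imports Defs begin

section \<open>Resolution derivations from complete decision trees\<close>

definition derivation :: "clause set \<Rightarrow> clause list \<Rightarrow> bool" where
  "derivation F \<pi> \<longleftrightarrow>
     (\<forall>i < length \<pi>. \<pi> ! i \<in> F \<or>
        (\<exists>D \<in> set (take i \<pi>). \<exists>E \<in> set (take i \<pi>). is_resolvent D E (\<pi> ! i)))"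

lemma derivation_snoc:
  "derivation F (\<pi> @ [R]) \<longleftrightarrow>
     derivation F \<pi> \<and> (R \<in> F \<or> (\<exists>D \<in> set \<pi>. \<exists>E \<in> set \<pi>. is_resolvent D E R))"
  by (simp add: derivation_def All_less_Suc nth_append conj_commute cong: conj_cong)

lemma derivation_append:
  "derivation F \<pi> \<Longrightarrow> derivation F \<pi>' \<Longrightarrow> derivation F (\<pi> @ \<pi>')"
proof (induction \<pi>' rule: rev_induct)
  case (snoc R \<pi>')
  then have "derivation F (\<pi> @ \<pi>')"
    by (simp add: derivation_snoc)
  moreover have "R \<in> F \<or> (\<exists>D \<in> set (\<pi> @ \<pi>'). \<exists>E \<in> set (\<pi> @ \<pi>'). is_resolvent D E R)"
    using snoc.prems(2) unfolding derivation_snoc by auto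
  ultimately show ?case
    unfolding append_assoc[symmetric] derivation_snoc by blast
qed simp

lemma derivation_mono: "derivation F \<pi> \<Longrightarrow> F \<subseteq> G \<Longrightarrow> derivation G \<pi>"
  unfolding derivation_def by blast

text \<open>\<open>derivation\<close> drops the demand on the last clause, so that a subtree may end
  in a nonempty clause. It takes premises from the set of earlier clauses instead of by index, so
  concatenating derivations requires no shifting of positions.\<close>

lemma resolution_refutation_iff:
  "resolution_refutation F \<pi> \<longleftrightarrow> \<pi> \<noteq> [] \<and> last \<pi> = {} \<and> derivation F \<pi>"
proof -
  have "(\<exists>j<i. \<exists>l<i. is_resolvent (\<pi> ! j) (\<pi> ! l) R) \<longleftrightarrow>
      (\<exists>D \<in> set (take i \<pi>). \<exists>E \<in> set (take i \<pi>). is_resolvent D E R)"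
    if "i < length \<pi>" for i R
    using nth_image[of i \<pi>] that by (simp add: Bex_def flip: nth_image)
  then show ?thesis
    unfolding resolution_refutation_def derivation_def by auto
qed

(* The node of the decision tree at which the variables of W - V have been queried, with answers
   given by \<sigma>, and those of V are still to be queried. *)
lemma decision_tree_derivation:
  assumes unsat: "\<And>\<sigma>. \<exists>D\<in>F. \<forall>(x, b)\<in>D. \<sigma> x \<noteq> b"
    and vars: "\<And>D. D \<in> F \<Longrightarrow> fst ` D \<subseteq> W"
    and "finite V"
  shows "\<exists>\<pi>. \<pi> \<noteq> [] \<and> derivation F \<pi> \<and> length \<pi> < 2 ^ Suc (card V) \<and>
    fst ` last \<pi> \<subseteq> W - V \<and> (\<forall>(x, b)\<in>last \<pi>. \<sigma> x \<noteq> b)"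
  using \<open>finite V\<close>
proof (induction V arbitrary: \<sigma> rule: finite_induct)
  case empty
  obtain D where "D \<in> F" "\<forall>(x, b)\<in>D. \<sigma> x \<noteq> b"
    using unsat by blast
  with vars show ?case
    by (intro exI[of _ "[D]"]) (auto simp: derivation_def)
next
  case (insert y V)
  obtain \<pi>1 where \<pi>1: "\<pi>1 \<noteq> []" "derivation F \<pi>1" "length \<pi>1 < 2 ^ Suc (card V)"
      "fst ` last \<pi>1 \<subseteq> W - V" "\<forall>(x, b)\<in>last \<pi>1. (\<sigma>(y := True)) x \<noteq> b"
    using insert.IH by blast
  obtain \<pi>2 where \<pi>2: "\<pi>2 \<noteq> []" "derivation F \<pi>2" "length \<pi>2 < 2 ^ Suc (card V)"
      "fst ` last \<pi>2 \<subseteq> W - V" "\<forall>(x, b)\<in>last \<pi>2. (\<sigma>(y := False)) x \<noteq> b"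
    using insert.IH by blast
  have card: "card (insert y V) = Suc (card V)"
    using insert by simp
  show ?case
  \<comment> \<open>A clause falsified under y = True can contain y only in the literal (y, False),
    and one falsified under y = False only in (y, True). So either the two final clauses resolve on
    y, or one of them avoids y and already serves at the parent node.\<close>
  proof (cases "(y, False) \<in> last \<pi>1 \<and> (y, True) \<in> last \<pi>2")
    case True
    define R where "R = (last \<pi>2 - {(y, True)}) \<union> (last \<pi>1 - {(y, False)})"
    have "is_resolvent (last \<pi>2) (last \<pi>1) R"
      using True by (auto simp: is_resolvent_def R_def)
    moreover have "last \<pi>1 \<in> set (\<pi>1 @ \<pi>2)" "last \<pi>2 \<in> set (\<pi>1 @ \<pi>2)"
      using \<pi>1(1) \<pi>2(1) by auto
    ultimately have deriv: "derivation F ((\<pi>1 @ \<pi>2) @ [R])"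
      using derivation_append[OF \<pi>1(2) \<pi>2(2)] unfolding derivation_snoc by blast
    have R: "\<sigma> x \<noteq> b \<and> x \<in> W - insert y V" if "(x, b) \<in> R" for x b
      using that \<pi>1(4,5) \<pi>2(4,5) by (cases "x = y"; cases b) (force simp: R_def)+
    have "fst ` R \<subseteq> W - insert y V" "\<forall>(x, b)\<in>R. \<sigma> x \<noteq> b"
      by (fastforce dest: R)+
    \<comment> \<open>Two lengths of at most 2^(|V|+1) - 1 and one resolvent add up to at most
      2^(|V|+2) - 1; the strict bound is what survives the induction.\<close>
    moreover have "length ((\<pi>1 @ \<pi>2) @ [R]) < 2 ^ Suc (card (insert y V))"
      using \<pi>1(3) \<pi>2(3) unfolding card by simp
    ultimately show ?thesis
      using deriv by (intro exI[of _ "(\<pi>1 @ \<pi>2) @ [R]"]) auto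
  next
    case False
    have "\<exists>\<pi>\<in>{\<pi>1, \<pi>2}. \<forall>(x, b)\<in>last \<pi>. \<sigma> x \<noteq> b \<and> x \<noteq> y"
    proof (cases "(y, False) \<in> last \<pi>1")
      case True
      with False have "(y, True) \<notin> last \<pi>2" by blast
      then have "\<sigma> x \<noteq> b \<and> x \<noteq> y" if "(x, b) \<in> last \<pi>2" for x b
        using that \<pi>2(5) by (cases "x = y"; cases b) force+
      then show ?thesis by blast
    next
      case False
      then have "\<sigma> x \<noteq> b \<and> x \<noteq> y" if "(x, b) \<in> last \<pi>1" for x b
        using that \<pi>1(5) by (cases "x = y"; cases b) force+
      then show ?thesis by blast
    qed
    then obtain \<pi> where \<pi>: "\<pi> \<in> {\<pi>1, \<pi>2}" "\<forall>(x, b)\<in>last \<pi>. \<sigma> x \<noteq> b \<and> x \<noteq> y"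
      by blast
    have "\<pi> \<noteq> []" "derivation F \<pi>" "length \<pi> < 2 ^ Suc (card V)" "fst ` last \<pi> \<subseteq> W - V"
      using \<pi>(1) \<pi>1 \<pi>2 by auto
    with \<pi>(2) show ?thesis
      unfolding card by (intro exI[of _ \<pi>]) fastforce
  qed
qed

lemma ex_resolution_refutation:
  assumes "\<And>\<sigma>. \<exists>D\<in>F. \<forall>(x, b)\<in>D. \<sigma> x \<noteq> b"
    and "\<And>D. D \<in> F \<Longrightarrow> fst ` D \<subseteq> V"
    and "finite V"
  shows "\<exists>\<pi>. resolution_refutation F \<pi> \<and> length \<pi> < 2 ^ Suc (card V)"
proof -
  \<comment> \<open>At the root nothing has been queried, so \<sigma> is arbitrary and the final
    clause, having no variables left, is empty.\<close>
  obtain \<pi> where "\<pi> \<noteq> []" "derivation F \<pi>" "length \<pi> < 2 ^ Suc (card V)" "fst ` last \<pi> \<subseteq> V - V"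
    using decision_tree_derivation[OF assms, where \<sigma> = "\<lambda>_. True"] by auto
  then show ?thesis
    unfolding resolution_refutation_iff by (intro exI[of _ \<pi>]) simp
qed

section \<open>Refutations of size exponential in the spine\<close>

lemma unsatisfiable_falsifies_clause:
  assumes "\<not> satisfiable F"
  shows "\<exists>D \<in> \<Union> (constraint_cnf ` F). \<forall>(x, b)\<in>D. \<sigma> x \<noteq> b"
proof -
  obtain xs C where "(xs, C) \<in> F" "map \<sigma> xs \<notin> C"
    using assms unfolding satisfiable_def by blast
  \<comment> \<open>A violated constraint forbids the very values that \<sigma> gives to xs, and the
    clause excluding these values has only false literals under \<sigma>.\<close>
  moreover from this have "set (zip xs (map Not (map \<sigma> xs))) \<in> constraint_cnf (xs, C)"
    unfolding constraint_cnf_def by force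
  moreover have "\<forall>(x, b)\<in>set (zip xs (map Not (map \<sigma> xs))). \<sigma> x \<noteq> b"
    by (auto simp: set_zip)
  ultimately show ?thesis by blast
qed

lemma vars_constraint_cnf: "D \<in> constraint_cnf (xs, C) \<Longrightarrow> fst ` D \<subseteq> set xs"
  by (auto simp: constraint_cnf_def dest: set_zip_leftD)

lemma ex_minimal_unsatisfiable:
  assumes "finite F" "\<not> satisfiable F"
  shows "\<exists>G \<subseteq> F. \<not> satisfiable G \<and> (\<forall>c\<in>G. satisfiable (G - {c}))"
  using assms
proof (induction F rule: finite_psubset_induct)
  case (psubset F)
  show ?case
  proof (cases "\<forall>c\<in>F. satisfiable (F - {c})")
    case True
    with psubset.prems show ?thesis by blast
  next
    case False
    then obtain c where "c \<in> F" "\<not> satisfiable (F - {c})"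
      by blast
    then show ?thesis
      using psubset.IH[of "F - {c}"] by blast
  qed
qed

lemma spine_mono: "set \<Phi> \<subseteq> set \<Psi> \<Longrightarrow> spine k P n \<Phi> \<subseteq> spine k P n \<Psi>"
  unfolding spine_def by (intro Collect_mono ex_mono conj_mono) auto

lemma spine_subset: "spine k P n \<Phi> \<subseteq> {..<n}"
  by (auto simp: spine_def)

lemma finite_spine: "finite (spine k P n \<Phi>)"
  by (rule finite_subset[OF spine_subset]) simp

lemma spine_0: "spine 0 P n \<Phi> = {}"
  by (auto simp: spine_def)

text \<open>These are exactly the constraints that \<open>spine\<close> allows to be added, so any
  constraint of a formula drawn from here can itself act as the witness in
  \<open>spine\<close>.\<close>

definition applied_constraints ::
    "nat \<Rightarrow> nat \<Rightarrow> boolean_constraint pmf \<Rightarrow> applied_constraint set" where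
  "applied_constraints k n P =
     {xs. length xs = k \<and> distinct xs \<and> set xs \<subseteq> {..<n}} \<times> set_pmf P"

text \<open>In the application \<Psi> is a prefix of \<Phi>: the spine is measured on the prefix
  only, while a refutation of the prefix also refutes \<Phi>.\<close>

lemma resolution_complexity_le_spine:
  assumes constr: "set \<Phi> \<subseteq> applied_constraints k n P"
    and sub: "set \<Psi> \<subseteq> set \<Phi>"
    and unsat: "\<not> satisfiable (set \<Psi>)"
  shows "resolution_complexity \<Phi> \<le> enat (2 ^ Suc (card (spine k P n \<Psi>)))"
proof -
  obtain \<Xi> where \<Xi>: "\<Xi> \<subseteq> set \<Psi>" "\<not> satisfiable \<Xi>" "\<And>c. c \<in> \<Xi> \<Longrightarrow> satisfiable (\<Xi> - {c})"
    using ex_minimal_unsatisfiable[OF _ unsat] by auto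
  have spine: "set xs \<subseteq> spine k P n \<Psi>" if "(xs, C) \<in> \<Xi>" for xs C
  proof -
    have "\<not> satisfiable (insert (xs, C) (\<Xi> - {(xs, C)}))"
      using \<Xi>(2) that by (simp add: insert_absorb)
    moreover have "(xs, C) \<in> applied_constraints k n P"
      using that \<Xi>(1) sub constr by blast
    moreover have "\<Xi> - {(xs, C)} \<subseteq> set \<Psi>"
      using \<Xi>(1) by blast
    ultimately show ?thesis
      using \<Xi>(3)[OF that] unfolding spine_def applied_constraints_def by blast
  qed
  have vars: "fst ` D \<subseteq> spine k P n \<Psi>" if "D \<in> \<Union> (constraint_cnf ` \<Xi>)" for D
    using that vars_constraint_cnf spine by fastforce
  obtain \<pi> where \<pi>: "resolution_refutation (\<Union> (constraint_cnf ` \<Xi>)) \<pi>"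
      "length \<pi> < 2 ^ Suc (card (spine k P n \<Psi>))"
    using ex_resolution_refutation[OF unsatisfiable_falsifies_clause[OF \<Xi>(2)] vars finite_spine]
    by auto
  have "\<Union> (constraint_cnf ` \<Xi>) \<subseteq> formula_cnf \<Phi>"
    using \<Xi>(1) sub unfolding formula_cnf_def by blast
  with \<pi>(1) have "resolution_refutation (formula_cnf \<Phi>) \<pi>"
    using derivation_mono by (auto simp: resolution_refutation_iff)
  then have "resolution_complexity \<Phi> \<le> enat (length \<pi>)"
    unfolding resolution_complexity_def by (intro INF_lower) simp
  also have "\<dots> \<le> enat (2 ^ Suc (card (spine k P n \<Psi>)))"
    using \<pi>(2) by (metis enat_ord_simps(1) less_imp_le)
  finally show ?thesis .
qed

section \<open>Support of the random model and prefixes of random formulas\<close>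

lemma set_pmf_random_applied_constraint:
  assumes "k \<le> n"
  shows "set_pmf (random_applied_constraint k n P) \<subseteq> applied_constraints k n P"
proof -
  let ?S = "{S. S \<subseteq> {..<n} \<and> card S = k}"
  have "finite ?S"
    by (rule finite_subset[of _ "Pow {..<n}"]) auto
  \<comment> \<open>This is where k \<le> n enters: \<open>pmf_of_set\<close> of the empty set has
    unspecified support.\<close>
  moreover have "?S \<noteq> {}"
    using assms by (auto intro!: exI[of _ "{..<k}"])
  ultimately have "set_pmf (pmf_of_set ?S) = ?S"
    by simp
  moreover have "set_pmf (pmf_of_set (permutations_of_set S)) = permutations_of_set S"
    if "S \<in> ?S" for S
    using that finite_subset[of S "{..<n}"] by (intro set_pmf_of_set) auto
  ultimately show ?thesis
    unfolding random_applied_constraint_def applied_constraints_def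
    by (auto dest: permutations_of_setD length_finite_permutations_of_set)
qed

lemma set_pmf_SAT_model:
  assumes "k \<le> n" "\<Phi> \<in> set_pmf (SAT_model k P n M)"
  shows "set \<Phi> \<subseteq> applied_constraints k n P"
  using assms set_pmf_random_applied_constraint[OF assms(1)]
  by (auto simp: SAT_model_def set_replicate_pmf)

text \<open>The coupling behind every comparison of different numbers of constraints: draws are
  independent, so the shorter formula can be realised as a prefix of the longer one.\<close>

lemma map_take_replicate_pmf:
  "m \<le> n \<Longrightarrow> map_pmf (take m) (replicate_pmf n p) = replicate_pmf m p"
proof (induction n arbitrary: m)
  case (Suc n)
  show ?case
  proof (cases m)
    case (Suc m')
    with Suc.prems Suc.IH[of m'] show ?thesis
      by (simp add: map_bind_pmf map_pmf_def bind_assoc_pmf bind_return_pmf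
          flip: Suc.IH[of m'])
  qed (simp add: map_pmf_def bind_return_pmf)
qed simp

lemma prob_SAT_model_take:
  assumes "m \<le> N"
  shows "measure_pmf.prob (SAT_model k P n N) {\<Phi>. Q (take m \<Phi>)} =
    measure_pmf.prob (SAT_model k P n m) {\<Phi>. Q \<Phi>}"
  unfolding SAT_model_def map_take_replicate_pmf[OF assms, symmetric]
  by (simp add: vimage_def)

lemma prob_large_spine_mono:
  assumes "m \<le> N"
  shows "measure_pmf.prob (SAT_model k P n m) {\<Phi>. \<epsilon> \<le> real (card (spine k P n \<Phi>)) / real n}
    \<le> measure_pmf.prob (SAT_model k P n N) {\<Phi>. \<epsilon> \<le> real (card (spine k P n \<Phi>)) / real n}"
proof -
  have "card (spine k P n (take m \<Phi>)) \<le> card (spine k P n \<Phi>)" for \<Phi>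
    by (intro card_mono finite_spine spine_mono set_take_subset)
  then have "real (card (spine k P n (take m \<Phi>))) / real n \<le> real (card (spine k P n \<Phi>)) / real n"
    for \<Phi>
    by (intro divide_right_mono) auto
  then show ?thesis
    unfolding prob_SAT_model_take[OF assms, symmetric]
    by (intro measure_pmf.finite_measure_mono) (auto intro: order_trans)
qed

section \<open>Relating the sharp threshold function to the threshold density\<close>

lemma prob_sat_above_threshold:
  assumes "sharp_threshold k P" and c: "limsup (threshold_density k P) < ereal c"
  shows "(\<lambda>n. prob_sat k P n (nat \<lfloor>c * real n\<rfloor>)) \<longlonglongrightarrow> 0"
proof -
  obtain t \<delta> where \<delta>: "\<delta> > 0" "\<forall>\<^sub>F n in sequentially. \<delta> \<le> t n"
    and t: "\<forall>\<epsilon>>0. \<forall>M :: nat \<Rightarrow> nat.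
       ((\<forall>\<^sub>F n in sequentially. real (M n) < (t n - \<epsilon>) * real n) \<longrightarrow>
          (\<lambda>n. prob_sat k P n (M n)) \<longlonglongrightarrow> 1) \<and>
       ((\<forall>\<^sub>F n in sequentially. real (M n) > (t n + \<epsilon>) * real n) \<longrightarrow>
          (\<lambda>n. prob_sat k P n (M n)) \<longlonglongrightarrow> 0)"
    using assms(1) unfolding sharp_threshold_def by (elim exE conjE)
  note below = t[rule_format, THEN conjunct1, rule_format]
    and above = t[rule_format, THEN conjunct2, rule_format]
  obtain d where d: "limsup (threshold_density k P) < ereal d" "d < c"
    using ereal_dense2[OF c] by auto
  have ev_d: "\<forall>\<^sub>F n in sequentially. threshold_density k P n < ereal d"
    using Limsup_lessD[OF d(1)] .
  \<comment> \<open>The gap between d and c is spent in three equal shares: one for t n \<le> d +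
    \<epsilon>, one for the margin demanded by the sharp threshold, and one to absorb the rounding
    of c n, whence n > 1 / \<epsilon> below.\<close>
  define \<epsilon> where "\<epsilon> = (c - d) / 3"
  have "\<epsilon> > 0" and cd: "c = d + 3 * \<epsilon>"
    using d(2) by (auto simp: \<epsilon>_def field_simps)
  \<comment> \<open>Nothing ties t to \<open>threshold_density\<close> by definition. But where t n
    > d + \<epsilon>, some number of constraints below d n, hence well below t n, already has
    satisfiability probability at most 1/2. The sharp threshold forces probabilities below t to tend
    to 1, so this happens for only finitely many n.\<close>
  have t_le: "\<forall>\<^sub>F n in sequentially. t n \<le> d + \<epsilon>"
  proof (rule ccontr)
    assume freq: "\<not> ?thesis"
    \<comment> \<open>Q n m says that m is such an offending number at n. The sharp threshold speaks
      of whole sequences, so \<open>M\<close> picks an offender where there is one and defaults to 0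
      elsewhere.\<close>
    define Q where "Q n m \<longleftrightarrow> real m < d * real n \<and> prob_sat k P n m \<le> 1 / 2 \<and> t n > d + \<epsilon>"
      for n m
    define M where "M n = (if \<exists>m. Q n m then SOME m. Q n m else 0)" for n
    have M_Q: "Q n (M n)" if "Q n m" for n m
      using that someI[of "Q n" m] by (auto simp: M_def)
    have M_cases: "Q n (M n) \<or> M n = 0" for n
    proof (cases "\<exists>m. Q n m")
      case True
      then show ?thesis using M_Q by blast
    next
      case False
      then show ?thesis by (simp add: M_def)
    qed
    \<comment> \<open>The bound \<epsilon> keeps the offenders below t n - \<eta>; the bound
      \<delta> / 2 keeps t n - \<eta> positive, as the default value 0 requires.\<close>
    define \<eta> where "\<eta> = min \<epsilon> (\<delta> / 2)"
    have "\<eta> > 0"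
      using \<open>\<epsilon> > 0\<close> \<delta>(1) by (simp add: \<eta>_def)
    have "\<forall>\<^sub>F n in sequentially. real (M n) < (t n - \<eta>) * real n"
      using \<delta>(2) eventually_gt_at_top[of 0]
    proof eventually_elim
      case (elim n)
      from M_cases[of n] show ?case
      proof
        assume "Q n (M n)"
        then have "real (M n) < d * real n" "d + \<epsilon> < t n"
          by (auto simp: Q_def)
        moreover from this have "d * real n \<le> (t n - \<eta>) * real n"
          by (intro mult_right_mono) (auto simp: \<eta>_def)
        ultimately show ?thesis by linarith
      next
        assume "M n = 0"
        with elim \<delta>(1) show ?thesis by (auto simp: \<eta>_def min_def)
      qed
    qed
    from below[OF \<open>\<eta> > 0\<close> this] have "\<forall>\<^sub>F n in sequentially. prob_sat k P n (M n) > 1 / 2"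
      by (rule order_tendstoD) simp
    then have "\<forall>\<^sub>F n in sequentially. t n \<le> d + \<epsilon>"
      using ev_d eventually_gt_at_top[of 0]
    proof eventually_elim
      case (elim n)
      \<comment> \<open>An infimum below d has a member below d, which is an offender whenever t n >
        d + \<epsilon>.\<close>
      obtain m where m: "prob_sat k P n m \<le> 1 / 2" "ereal (real m / real n) < ereal d"
        using elim(2) unfolding threshold_density_def INF_less_iff by blast
      then have "real m < d * real n"
        using elim(3) by (simp add: field_simps)
      with m(1) have "Q n m" if "t n > d + \<epsilon>"
        using that by (simp add: Q_def)
      with M_Q[of n m] have "prob_sat k P n (M n) \<le> 1 / 2" if "t n > d + \<epsilon>"
        using that by (simp add: Q_def)
      with elim(1) show ?case by fastforce
    qed
    with freq show False by contradiction
  qed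
  have "\<forall>\<^sub>F n in sequentially. real n > 1 / \<epsilon>"
    using filterlim_real_sequentially by (simp add: filterlim_at_top_dense)
  with t_le have "\<forall>\<^sub>F n in sequentially. real (nat \<lfloor>c * real n\<rfloor>) > (t n + \<epsilon>) * real n"
  proof eventually_elim
    case (elim n)
    have "(t n + \<epsilon>) * real n \<le> (d + 2 * \<epsilon>) * real n"
      using elim(1) by (intro mult_right_mono) auto
    also have "\<dots> = c * real n - \<epsilon> * real n"
      by (simp add: cd algebra_simps)
    also have "\<dots> < c * real n - 1"
      using elim(2) \<open>\<epsilon> > 0\<close> by (simp add: field_simps)
    also have "\<dots> < real (nat \<lfloor>c * real n\<rfloor>)"
      by linarith
    finally show ?case .
  qed
  from above[OF \<open>\<epsilon> > 0\<close> this] show ?thesis .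
qed

section \<open>Resolution complexity above the threshold\<close>

theorem theorem3:
  fixes k :: nat and P :: "boolean_constraint pmf"
  assumes "set_pmf P \<subseteq> boolean_constraints k"
    and "sharp_threshold k P"
    and "second_order_phase_transition k P"
  shows "\<forall>c \<alpha> :: real. limsup (threshold_density k P) < ereal c \<and> \<alpha> > 0 \<longrightarrow>
    (\<exists>K :: real.
       (\<lambda>n. measure_pmf.prob (SAT_model k P n (nat \<lfloor>c * real n\<rfloor>))
          {\<Phi>. ereal_of_enat (resolution_complexity \<Phi>)
               \<le> ereal (K * 2 powr (real k * \<alpha> * real n))}) \<longlonglongrightarrow> 1)"
proof (intro allI impI, elim conjE)
  fix c \<alpha> :: real
  assume c: "limsup (threshold_density k P) < ereal c" and \<alpha>: "\<alpha> > 0"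
  define N where "N n = nat \<lfloor>c * real n\<rfloor>" for n
  define large where "large n = {\<Phi>. \<alpha> \<le> real (card (spine k P n \<Phi>)) / real n}" for n
  \<comment> \<open>The constant K = 2 comes from the exponent |Spine| + 1 in the refutation
    size.\<close>
  define easy where "easy n = {\<Phi>. ereal_of_enat (resolution_complexity \<Phi>)
    \<le> ereal (2 * 2 powr (real k * \<alpha> * real n))}" for n
  obtain M where M: "(\<lambda>n. prob_sat k P n (M n)) \<longlonglongrightarrow> 0"
    and spine: "(\<lambda>n. measure_pmf.prob (SAT_model k P n (M n)) (large n)) \<longlonglongrightarrow> 0"
    using assms(3)[unfolded second_order_phase_transition_def, rule_format, OF \<alpha>]
    unfolding large_def by (elim exE conjE)
  \<comment> \<open>The prefix used below has length \<open>min (M n) (N n)\<close>, which may be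
    either number depending on n. Adding both satisfiability probabilities treats the two cases
    uniformly.\<close>
  define err where "err n = prob_sat k P n (M n) + prob_sat k P n (N n) +
    measure_pmf.prob (SAT_model k P n (M n)) (large n)" for n
  have "err \<longlonglongrightarrow> 0 + 0 + 0"
    unfolding err_def N_def by (intro tendsto_add M spine prob_sat_above_threshold assms c)
  then have "(\<lambda>n. 1 - err n) \<longlonglongrightarrow> 1 - (0 + 0 + 0)"
    by (intro tendsto_diff tendsto_const)
  then have lower: "(\<lambda>n. 1 - err n) \<longlonglongrightarrow> 1" by simp
  have easyI: "\<Phi> \<in> easy n"
    if "set \<Phi> \<subseteq> applied_constraints k n P" "n > 0"
      "\<not> satisfiable (set (take m \<Phi>))" "take m \<Phi> \<notin> large n" for \<Phi> n m
  proof -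
    let ?s = "card (spine k P n (take m \<Phi>))"
    have "real ?s \<le> real k * \<alpha> * real n"
    \<comment> \<open>For k > 0 the factor k is simply given away. For k = 0 the right-hand side is
      0, but the spine is then empty.\<close>
    proof (cases "k = 0")
      case True
      then show ?thesis by (simp add: spine_0)
    next
      case False
      have "real ?s \<le> 1 * (\<alpha> * real n)"
        using that(2,4) by (simp add: large_def field_simps)
      also have "\<dots> \<le> real k * (\<alpha> * real n)"
        using False \<alpha> by (intro mult_right_mono) auto
      finally show ?thesis by (simp add: mult.assoc)
    qed
    then have "2 powr real ?s \<le> 2 powr (real k * \<alpha> * real n)"
      by (intro powr_mono) auto
    then have "real (2 ^ Suc ?s) \<le> 2 * 2 powr (real k * \<alpha> * real n)"
      by (simp add: powr_realpow)
    moreover have "ereal_of_enat (resolution_complexity \<Phi>) \<le> ereal_of_enat (enat (2 ^ Suc ?s))"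
      unfolding ereal_of_enat_le_iff
      by (rule resolution_complexity_le_spine[OF that(1) set_take_subset that(3)])
    ultimately show ?thesis
      unfolding easy_def by (auto intro: order_trans)
  qed
  have "\<forall>\<^sub>F n in sequentially. 1 - err n \<le> measure_pmf.prob (SAT_model k P n (N n)) (easy n)"
    \<comment> \<open>k \<le> n places the support inside \<open>applied_constraints\<close>, and n
      > 0 makes the quotient in \<open>large\<close> a genuine density.\<close>
    using eventually_ge_at_top[of k] eventually_gt_at_top[of 0]
  proof eventually_elim
    case (elim n)
    let ?p = "SAT_model k P n (N n)"
    define m where "m = min (M n) (N n)"
    have "satisfiable (set (take m \<Phi>)) \<or> take m \<Phi> \<in> large n"
      if "\<Phi> \<in> set_pmf ?p" "\<Phi> \<notin> easy n" for \<Phi>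
      using easyI[OF set_pmf_SAT_model[OF elim(1) that(1)] elim(2)] that(2) by blast
    \<comment> \<open>The inclusion of events is known only on the support, hence the
      almost-everywhere form of monotonicity.\<close>
    then have "measure_pmf.prob ?p (- easy n)
        \<le> measure_pmf.prob ?p ({\<Phi>. satisfiable (set (take m \<Phi>))} \<union> {\<Phi>. take m \<Phi> \<in> large n})"
      by (intro measure_pmf.finite_measure_mono_AE) (auto simp: AE_measure_pmf_iff)
    also have "\<dots> \<le> measure_pmf.prob ?p {\<Phi>. satisfiable (set (take m \<Phi>))} +
        measure_pmf.prob ?p {\<Phi>. take m \<Phi> \<in> large n}"
      by (intro measure_Un_le) auto
    also have "\<dots> = prob_sat k P n m + measure_pmf.prob (SAT_model k P n m) (large n)"
      using prob_SAT_model_take[of m "N n" k P n "\<lambda>\<Phi>. satisfiable (set \<Phi>)"]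
        prob_SAT_model_take[of m "N n" k P n "\<lambda>\<Phi>. \<Phi> \<in> large n"]
      by (simp add: prob_sat_def m_def)
    also have "\<dots> \<le> err n"
    proof -
      have "prob_sat k P n m \<le> prob_sat k P n (M n) + prob_sat k P n (N n)"
        by (cases "M n \<le> N n") (auto simp: m_def prob_sat_def)
      moreover have "measure_pmf.prob (SAT_model k P n m) (large n)
          \<le> measure_pmf.prob (SAT_model k P n (M n)) (large n)"
        unfolding large_def by (intro prob_large_spine_mono) (simp add: m_def)
      ultimately show ?thesis by (simp add: err_def)
    qed
    finally show ?case
      using measure_pmf.prob_compl[of "easy n" ?p] by (simp add: Compl_eq_Diff_UNIV)
  qed
  then have "(\<lambda>n. measure_pmf.prob (SAT_model k P n (N n)) (easy n)) \<longlonglongrightarrow> 1"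
    by (rule tendsto_sandwich[OF _ _ lower tendsto_const]) simp
  then show "\<exists>K :: real. (\<lambda>n. measure_pmf.prob (SAT_model k P n (nat \<lfloor>c * real n\<rfloor>))
      {\<Phi>. ereal_of_enat (resolution_complexity \<Phi>)
        \<le> ereal (K * 2 powr (real k * \<alpha> * real n))}) \<longlonglongrightarrow> 1"
    unfolding N_def easy_def by blast
qed

end
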